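(* Let $(E,w,d)$ be a $\mathbb{V}$-ultra triple such that $E$ is finite, and let $\mathcal{F}$ be the Bhargava greedoid of $(E,w,d)$. Let $\mathbb{K}$ be a field with $|\mathbb{K}|\geq \mathrm{mcs}(E,w,d)$. Then $\mathcal{F}$ is the Gaussian elimination greedoid of a vector family over $\mathbb{K}$.
   Context: $\mathbb{V}$ is a totally ordered abelian group (translation-invariant total order). For a set $E$, $E\times_{\neq}E=\{(e,f)\in E\times E: e\neq f\}$. A $\mathbb{V}$-ultra triple is $(E,w,d)$ with $E$ a set, $w:E\to\mathbb{V}$, $d:E\times_{\neq}E\to\mathbb{V}$ satisfying $d(a,b)=d(b,a)$ for distinct $a,b$ and $d(a,b)\le\max\{d(a,c),d(b,c)\}$ for distinct $a,b,c$. Perimeter of finite $A\subseteq E$: $\mathrm{PER}(A)=\sum_{a\in A}w(a)+\sum_{\{a,b\}\subseteq A,\ a\neq b}d(a,b)$ (unordered pairs). For finite $E$, the Bhargava greedoid of $(E,w,d)$ is $\{A\subseteq E:\ \mathrm{PER}(A)\ge\mathrm{PER}(B)\ \forall B\subseteq E,\ |B|=|A|\}$. For $\alpha\in\mathbb{V}$, an $\alpha$-clique is a subset $F\subseteq E$ such that $d(a,b)=\alpha$ for all distinct $a,b\in F$; a clique is a subset that is an $\alpha$-clique for some $\alpha\in\mathbb{V}$. $\mathrm{mcs}(E,w,d)$ is the maximum size of a clique of $(E,w,d)$. Gaussian elimination greedoid: for a finite set $E$, a field $\mathbb{K}$, $m\ge|E|$ and vectors $v_e\in\mathbb{K}^m$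 ($e\in E$), with $\pi_k:\mathbb{K}^m\to\mathbb{K}^k$ the projection onto the first $k$ coordinates, it is $\{F\subseteq E:\ (\pi_{|F|}(v_e))_{e\in F}\text{ linearly independent}\}$. *)

theory Defs
  imports "Jordan_Normal_Form.VS_Connect"
begin

text \<open>
  The totally ordered abelian group is a type of class \<^class>\<open>linordered_ab_group_add\<close>.
  The map \<open>d\<close> is total on \<open>'e \<times> 'e\<close>; its values outside \<open>{(e, f) \<in> E \<times> E. e \<noteq> f}\<close> are
  unconstrained and irrelevant to all the notions below.
\<close>

definition ultra_triple ::
    "'e set \<Rightarrow> ('e \<Rightarrow> 'v::linordered_ab_group_add) \<Rightarrow> ('e \<Rightarrow> 'e \<Rightarrow> 'v) \<Rightarrow> bool" where
  "ultra_triple E w d \<longleftrightarrow>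
     (\<forall>a\<in>E. \<forall>b\<in>E. a \<noteq> b \<longrightarrow> d a b = d b a) \<and>
     (\<forall>a\<in>E. \<forall>b\<in>E. \<forall>c\<in>E. a \<noteq> b \<and> a \<noteq> c \<and> b \<noteq> c \<longrightarrow> d a b \<le> max (d a c) (d b c))"

text \<open>
  The value of \<open>d\<close> on an unordered pair \<open>{a, b}\<close>, well defined when \<open>d a b = d b a\<close>.  Summing over
  two-element sets avoids halving a sum over ordered pairs, which is not available in an
  arbitrary abelian group.
\<close>

definition pair_dist :: "('e \<Rightarrow> 'e \<Rightarrow> 'v) \<Rightarrow> 'e set \<Rightarrow> 'v" where
  "pair_dist d P = (THE x. \<exists>a b. a \<noteq> b \<and> P = {a, b} \<and> x = d a b)"

lemma pair_dist_eq:
  assumes "a \<noteq> b" and "d a b = d b a"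
  shows "pair_dist d {a, b} = d a b"
  unfolding pair_dist_def
proof (rule the_equality)
  show "\<exists>a' b'. a' \<noteq> b' \<and> {a, b} = {a', b'} \<and> d a b = d a' b'"
    using assms(1) by blast
qed (use assms(2) in \<open>auto simp: doubleton_eq_iff\<close>)

definition perimeter ::
    "('e \<Rightarrow> 'v::linordered_ab_group_add) \<Rightarrow> ('e \<Rightarrow> 'e \<Rightarrow> 'v) \<Rightarrow> 'e set \<Rightarrow> 'v" where
  "perimeter w d A = (\<Sum>a\<in>A. w a) + (\<Sum>P | P \<subseteq> A \<and> card P = 2. pair_dist d P)"

definition bhargava_greedoid ::
    "'e set \<Rightarrow> ('e \<Rightarrow> 'v::linordered_ab_group_add) \<Rightarrow> ('e \<Rightarrow> 'e \<Rightarrow> 'v) \<Rightarrow> 'e set set" where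
  "bhargava_greedoid E w d =
     {A. A \<subseteq> E \<and> (\<forall>B. B \<subseteq> E \<and> card B = card A \<longrightarrow> perimeter w d A \<ge> perimeter w d B)}"

definition alpha_clique :: "'e set \<Rightarrow> ('e \<Rightarrow> 'e \<Rightarrow> 'v) \<Rightarrow> 'v \<Rightarrow> 'e set \<Rightarrow> bool" where
  "alpha_clique E d \<alpha> F \<longleftrightarrow> F \<subseteq> E \<and> (\<forall>a\<in>F. \<forall>b\<in>F. a \<noteq> b \<longrightarrow> d a b = \<alpha>)"

definition clique :: "'e set \<Rightarrow> ('e \<Rightarrow> 'e \<Rightarrow> 'v) \<Rightarrow> 'e set \<Rightarrow> bool" where
  "clique E d F \<longleftrightarrow> (\<exists>\<alpha>. alpha_clique E d \<alpha> F)"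

text \<open>Meaningful for finite \<open>E\<close>; the empty set is always a clique.\<close>

definition mcs :: "'e set \<Rightarrow> ('e \<Rightarrow> 'v) \<Rightarrow> ('e \<Rightarrow> 'e \<Rightarrow> 'v) \<Rightarrow> nat" where
  "mcs E w d = Max (card ` {F. clique E d F})"

text \<open>
  Linear independence of a family, as opposed to a set: the vectors are pairwise distinct and
  form a linearly independent set in \<open>K\<^sup>k\<close>.
\<close>

definition lin_indpt_family :: "nat \<Rightarrow> 'e set \<Rightarrow> ('e \<Rightarrow> 'k::field vec) \<Rightarrow> bool" where
  "lin_indpt_family k F u \<longleftrightarrow>
     inj_on u F \<and> module.lin_indpt class_ring (module_vec TYPE('k) k) (u ` F)"

text \<open>
  For vectors in \<open>carrier_vec m\<close> with \<open>k \<le> m\<close>, \<^const>\<open>vec_first\<close> is the projection onto the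
  first \<open>k\<close> coordinates.
\<close>

definition gaussian_elimination_greedoid :: "'e set \<Rightarrow> ('e \<Rightarrow> 'k::field vec) \<Rightarrow> 'e set set" where
  "gaussian_elimination_greedoid E v =
     {F. F \<subseteq> E \<and> lin_indpt_family (card F) F (\<lambda>e. vec_first (v e) (card F))}"

end

theory Submission
  imports Defs "Jordan_Normal_Form.DL_Rank" "HOL-Library.Poly_Mapping"
begin

text \<open>
  Work in the group algebra \<open>K[V]\<close> with formal powers \<open>t^\<alpha>\<close> and degrees in \<open>V\<close>.  The bound on cliques
  yields elements \<open>\<phi> e\<close> with \<open>deg (\<phi> e - \<phi> f) = d e f\<close>, so the perimeter of \<open>A\<close> is the degree of the
  Vandermonde determinant of \<open>\<phi>\<close> on \<open>A\<close> whose column at \<open>e\<close> is scaled by \<open>t^(w e)\<close>.  Enumerate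
  \<open>E\<close> greedily as \<open>a\<^sub>0, a\<^sub>1, \<dots>\<close> and replace the monomial rows by the Newton rows
  \<open>\<Prod>i<j. \<phi> e - \<phi> a\<^sub>i\<close>, normalised by a power of \<open>t\<close> so as to have degree \<open>0\<close> at \<open>a\<^sub>j\<close>.  Greediness
  says that all entries then have degree at most \<open>0\<close>.  Hence so do the minors on the first \<open>k\<close>
  rows, and such a minor has degree exactly \<open>0\<close> iff the perimeter is maximal.  Taking constant
  coefficients is a ring homomorphism on elements of degree at most \<open>0\<close>, and it turns the rows
  into the required vectors over \<open>K\<close>.
\<close>

section \<open>Top coefficients in the group algebra\<close>

abbreviation "keys \<equiv> Poly_Mapping.keys"
abbreviation "lookup \<equiv> Poly_Mapping.lookup"

text \<open>The inclusion \<open>keys p \<subseteq> {..a}\<close> plays the part of "degree at most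
  \<open>a\<close>". It also covers zero, so no degree of zero has to be chosen.\<close>

lemma keys_mult_atMost:
  fixes p q :: "'v::linordered_ab_group_add \<Rightarrow>\<^sub>0 'k::comm_ring_1"
  assumes "keys p \<subseteq> {..a}" "keys q \<subseteq> {..b}"
  shows "keys (p * q) \<subseteq> {..a + b}"
proof
  fix k assume "k \<in> keys (p * q)"
  then obtain i j where "k = i + j" "i \<in> keys p" "j \<in> keys q"
    using keys_mult[of p q] by blast
  then show "k \<in> {..a + b}" using assms by (auto intro: add_mono)
qed

text \<open>Exponents l \<le> a and r \<le> b add up to a + b only if l = a and r = b, so a single
  term of the convolution survives.\<close>

lemma lookup_mult_top:
  fixes p q :: "'v::linordered_ab_group_add \<Rightarrow>\<^sub>0 'k::comm_ring_1"
  assumes "keys p \<subseteq> {..a}" "keys q \<subseteq> {..b}"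
  shows "lookup (p * q) (a + b) = lookup p a * lookup q b"
proof -
  have "lookup p l * (\<Sum>r. lookup q r when a + b = l + r) = (lookup p a * lookup q b when l = a)" for l
  proof -
    have inner: "(\<Sum>r. lookup q r when a + b = l + r) = lookup q (a + b - l)"
    proof -
      have "a + b = l + r \<longleftrightarrow> r = a + b - l" for r by (auto simp: algebra_simps)
      then show ?thesis by simp
    qed
    consider "l = a" | "l < a" | "a < l" by force
    then show ?thesis
    proof cases
      case 2
      then have "b < a + b - l" by (simp add: algebra_simps)
      then have "a + b - l \<notin> keys q" using assms(2) by force
      then show ?thesis unfolding inner using 2 by (simp add: in_keys_iff)
    next
      case 3
      then have "l \<notin> keys p" using assms(1) by force
      then show ?thesis using 3 by (simp add: in_keys_iff)
    qed (simp add: inner)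
  qed
  then show ?thesis by (simp add: lookup_mult)
qed

lemma prod_top:
  fixes f :: "'a \<Rightarrow> ('v::linordered_ab_group_add \<Rightarrow>\<^sub>0 'k::comm_ring_1)"
  assumes "\<And>x. x \<in> S \<Longrightarrow> keys (f x) \<subseteq> {..a x}"
  shows "keys (prod f S) \<subseteq> {..sum a S}"
    and "lookup (prod f S) (sum a S) = (\<Prod>x\<in>S. lookup (f x) (a x))"
proof -
  have "keys (prod f S) \<subseteq> {..sum a S} \<and>
        lookup (prod f S) (sum a S) = (\<Prod>x\<in>S. lookup (f x) (a x))"
    using assms
  proof (induction S rule: infinite_finite_induct)
    case (insert x S)
    then show ?case by (simp add: keys_mult_atMost lookup_mult_top)
  qed simp_all
  then show "keys (prod f S) \<subseteq> {..sum a S}"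
    and "lookup (prod f S) (sum a S) = (\<Prod>x\<in>S. lookup (f x) (a x))" by auto
qed

lemma keys_sum_subset:
  assumes "\<And>x. x \<in> S \<Longrightarrow> keys (f x) \<subseteq> T"
  shows "keys (sum f S) \<subseteq> T"
  using assms
proof (induction S rule: infinite_finite_induct)
  case (insert x S)
  then show ?case using keys_add[of "f x" "sum f S"] by fastforce
qed simp_all

text \<open>Elements with all exponents at most 0 form a subring on which the coefficient at 0 is
  multiplicative. The determinant is a signed sum of products of entries, so it stays in this
  subring and commutes with taking that coefficient.\<close>

lemma det_top:
  fixes A :: "('v::linordered_ab_group_add \<Rightarrow>\<^sub>0 'k::comm_ring_1) mat"
  assumes A: "A \<in> carrier_mat n n"
    and le: "\<And>i j. i < n \<Longrightarrow> j < n \<Longrightarrow> keys (A $$ (i, j)) \<subseteq> {..0}"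
  shows "keys (det A) \<subseteq> {..0}"
    and "lookup (det A) 0 = det (map_mat (\<lambda>p. lookup p 0) A)"
proof -
  let ?P = "{p. p permutes {0..<n}}"
  have B: "map_mat (\<lambda>p. lookup p 0) A \<in> carrier_mat n n" using A by simp
  have lt: "p i < n" if "p \<in> ?P" "i < n" for p i
    using that permutes_in_image[of p "{0..<n}" i] by simp
  have pr: "keys (\<Prod>i<n. A $$ (p i, i)) \<subseteq> {..0}"
    "lookup (\<Prod>i<n. A $$ (p i, i)) 0 = (\<Prod>i<n. lookup (A $$ (p i, i)) 0)" if "p \<in> ?P" for p
    using prod_top[of "{..<n}" "\<lambda>i. A $$ (p i, i)" "\<lambda>_. 0"] le lt[OF that] by auto
  have sg: "keys (signof p * q) \<subseteq> {..0}" "lookup (signof p * q) 0 = signof p * lookup q 0"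
    if "keys q \<subseteq> {..0}" for p and q :: "'v \<Rightarrow>\<^sub>0 'k"
    using that by (auto simp: sign_def in_keys_iff)
  show "keys (det A) \<subseteq> {..0}"
    unfolding det_col[OF A] by (intro keys_sum_subset sg pr) simp
  have "lookup (det A) 0 = (\<Sum>p\<in>?P. signof p * (\<Prod>i<n. lookup (A $$ (p i, i)) 0))"
    unfolding det_col[OF A] lookup_sum by (intro sum.cong refl) (simp add: sg pr)
  also have "\<dots> = det (map_mat (\<lambda>p. lookup p 0) A)"
    unfolding det_col[OF B] using A lt
    by (intro sum.cong refl arg_cong2[of _ _ _ _ "(*)"] prod.cong) auto
  finally show "lookup (det A) 0 = det (map_mat (\<lambda>p. lookup p 0) A)" .
qed

section \<open>The Vandermonde determinant in Newton form\<close>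

text \<open>Each term of the Leibniz formula contains every row factor and every column factor
  exactly once.\<close>

lemma det_scale_rows_cols:
  fixes f :: "nat \<Rightarrow> nat \<Rightarrow> 'a::comm_ring_1"
  shows "det (mat n n (\<lambda>(i, j). r i * s j * f i j)) =
    (\<Prod>i<n. r i) * (\<Prod>j<n. s j) * det (mat n n (\<lambda>(i, j). f i j))"
proof -
  have "(\<Prod>i<n. mat n n (\<lambda>(i, j). r i * s j * f i j) $$ (p i, i)) =
      (\<Prod>i<n. r i) * (\<Prod>j<n. s j) * (\<Prod>i<n. mat n n (\<lambda>(i, j). f i j) $$ (p i, i))"
    if p: "p permutes {0..<n}" for p
  proof -
    have lt: "p i < n" if "i < n" for i using permutes_in_image[OF p, of i] that by simp
    have "(\<Prod>i<n. r (p i)) = (\<Prod>i<n. r i)"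
      using prod.permute[OF p, of r] by (simp add: lessThan_atLeast0 o_def)
    then show ?thesis by (simp add: lt prod.distrib)
  qed
  then show ?thesis
    by (simp add: det_col[of _ n] sum_distrib_left mult_ac)
qed

text \<open>The evaluation matrix factors as the coefficient matrix times the Vandermonde matrix,
  and the former is lower triangular with unit diagonal.\<close>

lemma det_monic_eval:
  fixes p :: "nat \<Rightarrow> 'a::comm_ring_1 poly"
  assumes "\<And>j. j < n \<Longrightarrow> lead_coeff (p j) = 1" "\<And>j. j < n \<Longrightarrow> Polynomial.degree (p j) = j"
  shows "det (mat n n (\<lambda>(j, l). poly (p j) (x l))) = det (mat n n (\<lambda>(j, l). x l ^ j))"
proof -
  let ?C = "mat n n (\<lambda>(j, i). coeff (p j) i)" and ?V = "mat n n (\<lambda>(j, l). x l ^ j)"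
  have "poly (p j) (x l) = (\<Sum>i = 0..<n. coeff (p j) i * x l ^ i)" if "j < n" for j l
    unfolding poly_altdef using that assms(2)[OF that]
    by (intro sum.mono_neutral_left) (auto simp: coeff_eq_0)
  then have "mat n n (\<lambda>(j, l). poly (p j) (x l)) = ?C * ?V"
    by (intro eq_matI) (auto simp: scalar_prod_def)
  moreover have "det ?C = prod_list (diag_mat ?C)"
    by (rule det_lower_triangular[of n]) (auto simp: coeff_eq_0 assms(2))
  moreover have "prod_list (diag_mat ?C) = 1"
    unfolding prod_list_diag_prod
  proof (intro prod.neutral ballI)
    fix j assume "j \<in> {0..<dim_row ?C}"
    then show "?C $$ (j, j) = 1" using assms[of j] by simp
  qed
  ultimately show ?thesis by (simp add: det_mult[of _ n])
qed

text \<open>Newton polynomials are monic of degree \<open>j\<close> whatever their nodes, so every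
  choice of nodes gives the Vandermonde determinant.\<close>

lemma det_newton:
  fixes x a :: "nat \<Rightarrow> 'a::idom"
  shows "det (mat n n (\<lambda>(j, l). \<Prod>i<j. x l - a i)) = (\<Prod>j<n. \<Prod>i<j. x j - x i)"
proof -
  have *: "det (mat n n (\<lambda>(j, l). \<Prod>i<j. x l - b i)) = det (mat n n (\<lambda>(j, l). x l ^ j))" for b
  proof -
    let ?p = "\<lambda>j. \<Prod>i<j. [:- b i, 1:]"
    have "lead_coeff (?p j) = 1" for j by (simp add: lead_coeff_prod)
    moreover have "Polynomial.degree (?p j) = j" for j by (simp add: degree_prod_eq_sum_degree)
    ultimately have "det (mat n n (\<lambda>(j, l). poly (?p j) (x l))) = det (mat n n (\<lambda>(j, l). x l ^ j))"
      by (intro det_monic_eval)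
    then show ?thesis by (simp add: poly_prod)
  qed
  let ?N = "mat n n (\<lambda>(j, l). \<Prod>i<j. x l - x i)"
  \<comment> \<open>Taking the interpolation nodes to be the points themselves makes the matrix triangular.\<close>
  have "det ?N = prod_list (diag_mat ?N)"
    by (rule det_upper_triangular[of _ n]) (auto simp: upper_triangular_def)
  also have "\<dots> = (\<Prod>j<n. \<Prod>i<j. x j - x i)"
    unfolding prod_list_diag_prod by (simp add: lessThan_atLeast0)
  finally show ?thesis using *[of a] *[of x] by simp
qed

section \<open>Embedding an ultra triple into the group algebra\<close>

lemma ultra_triple_subset: "ultra_triple E w d \<Longrightarrow> F \<subseteq> E \<Longrightarrow> ultra_triple F w d"
  unfolding ultra_triple_def by blast

lemma ultra_sym: "ultra_triple E w d \<Longrightarrow> a \<in> E \<Longrightarrow> b \<in> E \<Longrightarrow> d a b = d b a"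
  unfolding ultra_triple_def by (cases "a = b") auto

lemma ultra_le:
  assumes "ultra_triple E w d" "a \<in> E" "b \<in> E" "c \<in> E" "a \<noteq> b" "a \<noteq> c" "b \<noteq> c"
  shows "d a b \<le> max (d a c) (d c b)"
  using assms unfolding ultra_triple_def by metis

text \<open>Induction on the points. A new point \<open>x\<close> must copy the colour of any old
  point closer than \<alpha>. If there is none, it only has to avoid the colours seen at distance
  \<alpha>, and the clique bound leaves one free. The disjunct \<open>infinite\<close> is there
  because \<open>card\<close> is 0 on infinite sets.\<close>

lemma ball_colouring:
  fixes d :: "'e \<Rightarrow> 'e \<Rightarrow> 'v::linordered_ab_group_add"
  assumes "finite E" "ultra_triple E w d"
    and "\<And>F. alpha_clique E d \<alpha> F \<Longrightarrow> infinite (UNIV :: 'k set) \<or> card F \<le> card (UNIV :: 'k set)"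
  shows "\<exists>c :: 'e \<Rightarrow> 'k. \<forall>e\<in>E. \<forall>f\<in>E. e \<noteq> f \<longrightarrow>
    (d e f < \<alpha> \<longrightarrow> c e = c f) \<and> (d e f = \<alpha> \<longrightarrow> c e \<noteq> c f)"
  using assms
proof (induction E rule: finite_induct)
  case (insert x E)
  note ult = insert.prems(1)
  have "ultra_triple E w d" using ultra_triple_subset[OF ult] by blast
  moreover have "infinite (UNIV :: 'k set) \<or> card F \<le> card (UNIV :: 'k set)"
    if "alpha_clique E d \<alpha> F" for F
    using that insert.prems(2)[of F] unfolding alpha_clique_def by blast
  ultimately obtain c :: "'e \<Rightarrow> 'k" where c: "\<And>e f. e \<in> E \<Longrightarrow> f \<in> E \<Longrightarrow> e \<noteq> f \<Longrightarrow> d e f < \<alpha> \<Longrightarrow> c e = c f"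
     "\<And>e f. e \<in> E \<Longrightarrow> f \<in> E \<Longrightarrow> e \<noteq> f \<Longrightarrow> d e f = \<alpha> \<Longrightarrow> c e \<noteq> c f"
    using insert.IH by metis
  have sym: "d e f = d f e" if "e \<in> insert x E" "f \<in> insert x E" for e f
    using ultra_sym[OF ult] that by blast
  have le: "d e f \<le> max (d e g) (d g f)"
    if "e \<in> insert x E" "f \<in> insert x E" "g \<in> insert x E" "e \<noteq> f" "e \<noteq> g" "f \<noteq> g" for e f g
    using ultra_le[OF ult] that by blast
  obtain y where y: "\<And>f. f \<in> E \<Longrightarrow> d x f < \<alpha> \<Longrightarrow> y = c f" "\<And>f. f \<in> E \<Longrightarrow> d x f = \<alpha> \<Longrightarrow> y \<noteq> c f"
  proof (cases "\<exists>g\<in>E. d x g < \<alpha>")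
    case True
    then obtain g where g: "g \<in> E" "d x g < \<alpha>" by blast
    \<comment> \<open>By the ultrametric inequality, another point closer than \<alpha> to
      \<open>x\<close> is closer than \<alpha> to \<open>g\<close>, and one at distance \<alpha>
      from \<open>x\<close> is at distance \<alpha> from \<open>g\<close>. So the colour of
      \<open>g\<close> suits \<open>x\<close>.\<close>
    show ?thesis
    proof (rule that[of "c g"])
      fix f assume f: "f \<in> E" "d x f < \<alpha>"
      show "c g = c f"
      proof (cases "f = g")
        case False
        have "d g f \<le> max (d g x) (d x f)" using le[of g f x] f g insert.hyps False by auto
        also have "\<dots> < \<alpha>" using f g sym[of g x] by auto
        finally have "d g f < \<alpha>" .
        then show ?thesis using c(1)[of g f] f g False by auto
      qed simp
    next
      fix f assume f: "f \<in> E" "d x f = \<alpha>"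
      have ne: "f \<noteq> g" using f g by auto
      have "d g f \<le> max (d g x) (d x f)" using le[of g f x] f g insert.hyps ne by auto
      then have "d g f \<le> \<alpha>" using f g sym[of g x] by auto
      moreover have "d x f \<le> max (d x g) (d g f)" using le[of x f g] f g insert.hyps ne by auto
      then have "\<alpha> \<le> d g f" using f g by (auto simp: le_max_iff_disj)
      ultimately show "c g \<noteq> c f" using c(2)[of g f] f g ne by auto
    qed
  next
    case False
    define S where "S = {f \<in> E. d x f = \<alpha>}"
    \<comment> \<open>\<open>R\<close> has one point for each colour occurring on \<open>S\<close>.
      Two of its points differ in colour, hence are not closer than \<alpha>, and comparison through
      \<open>x\<close> gives at most \<alpha>. Adding \<open>x\<close> yields a clique with one
      point more than \<open>S\<close> has colours.\<close>
    obtain R where R: "R \<subseteq> S" "inj_on c R" "c ` R = c ` S" using subset_image_inj[of "c ` S" c S] by auto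
    have "d e f = \<alpha>" if "e \<in> R" "f \<in> R" "e \<noteq> f" for e f
    proof -
      have ef: "e \<in> E" "f \<in> E" "d x e = \<alpha>" "d x f = \<alpha>" using that R(1) S_def by auto
      have "d e f \<le> max (d e x) (d x f)" using le[of e f x] ef insert.hyps that by auto
      then have "d e f \<le> \<alpha>" using ef sym[of e x] by auto
      moreover have "\<not> d e f < \<alpha>" using c(1)[of e f] ef that R(2) by (auto simp: inj_on_def)
      ultimately show ?thesis by auto
    qed
    then have "alpha_clique (insert x E) d \<alpha> (insert x R)"
      using R(1) sym unfolding alpha_clique_def S_def by auto
    then have bound: "infinite (UNIV :: 'k set) \<or> card (insert x R) \<le> card (UNIV :: 'k set)"
      by (rule insert.prems(2))
    have fin: "finite R" "x \<notin> R" using R(1) insert.hyps S_def by (auto intro: finite_subset)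
    have "c ` S \<noteq> UNIV"
    proof
      assume U: "c ` S = UNIV"
      then have "finite (UNIV :: 'k set)" using R(3) fin by (metis finite_imageI)
      moreover have "card (UNIV :: 'k set) = card R" using U R by (metis card_image)
      ultimately show False using bound fin by auto
    qed
    then obtain y where "y \<notin> c ` S" by blast
    then show ?thesis using that[of y] False S_def by auto
  qed
  have "(d e f < \<alpha> \<longrightarrow> (c(x := y)) e = (c(x := y)) f) \<and>
      (d e f = \<alpha> \<longrightarrow> (c(x := y)) e \<noteq> (c(x := y)) f)"
    if ef: "e \<in> insert x E" "f \<in> insert x E" "e \<noteq> f" for e f
  proof -
    consider "e = x" "f \<in> E" "f \<noteq> x" | "f = x" "e \<in> E" "e \<noteq> x" | "e \<in> E" "f \<in> E" "e \<noteq> x" "f \<noteq> x"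
      using ef by blast
    then show ?thesis
    proof cases
      case 1
      then show ?thesis using y[of f] by auto
    next
      case 2
      then show ?thesis using y[of e] sym[OF ef(1,2)] by auto
    next
      case 3
      then show ?thesis using c[of e f] ef(3) by simp
    qed
  qed
  then show ?case by blast
qed simp

lemma clique_card_le_mcs:
  assumes "finite E" "alpha_clique E d \<alpha> F"
  shows "card F \<le> mcs E w d"
proof -
  have "{F. clique E d F} \<subseteq> Pow E" by (auto simp: clique_def alpha_clique_def)
  then have "finite {F. clique E d F}" using assms(1) by (meson finite_Pow_iff finite_subset)
  then show ?thesis using assms(2) unfolding mcs_def clique_def by (intro Max_ge) auto
qed

text \<open>The coefficient of \<open>\<phi> e\<close> at \<open>\<alpha>\<close> tells apart the open balls of radius \<open>\<alpha>\<close> inside the closed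
  ball of radius \<open>\<alpha>\<close> around \<open>e\<close>; representatives of these open balls form an \<open>\<alpha>\<close>-clique.\<close>

lemma valadic_embedding:
  fixes d :: "'e \<Rightarrow> 'e \<Rightarrow> 'v::linordered_ab_group_add"
  assumes fin: "finite E" and ult: "ultra_triple E w d"
    and card: "infinite (UNIV :: 'k::comm_ring_1 set) \<or> card (UNIV :: 'k::comm_ring_1 set) \<ge> mcs E w d"
  obtains \<phi> :: "'e \<Rightarrow> ('v \<Rightarrow>\<^sub>0 'k::comm_ring_1)" where
    "\<And>e f. e \<in> E \<Longrightarrow> f \<in> E \<Longrightarrow> e \<noteq> f \<Longrightarrow> keys (\<phi> e - \<phi> f) \<subseteq> {..d e f}"
    "\<And>e f. e \<in> E \<Longrightarrow> f \<in> E \<Longrightarrow> e \<noteq> f \<Longrightarrow> lookup (\<phi> e - \<phi> f) (d e f) \<noteq> 0"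
proof -
  have "\<exists>c :: 'e \<Rightarrow> 'k. \<forall>e\<in>E. \<forall>f\<in>E. e \<noteq> f \<longrightarrow>
      (d e f < \<alpha> \<longrightarrow> c e = c f) \<and> (d e f = \<alpha> \<longrightarrow> c e \<noteq> c f)" for \<alpha>
    using card clique_card_le_mcs[OF fin, of d \<alpha> _ w]
    by (intro ball_colouring[OF fin ult]) (meson order.trans)
  then obtain c :: "'v \<Rightarrow> 'e \<Rightarrow> 'k" where
    c: "\<And>\<alpha> e f. e \<in> E \<Longrightarrow> f \<in> E \<Longrightarrow> e \<noteq> f \<Longrightarrow>
      (d e f < \<alpha> \<longrightarrow> c \<alpha> e = c \<alpha> f) \<and> (d e f = \<alpha> \<longrightarrow> c \<alpha> e \<noteq> c \<alpha> f)" by metis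
  \<comment> \<open>Only exponents that are values of \<open>d\<close> are used, which keeps the
    support finite. Arbitrary diagonal values in \<open>D\<close> do no harm, since \<open>c\<close>
    is controlled at every \<alpha>.\<close>
  define D where "D = (\<lambda>(e, f). d e f) ` (E \<times> E)"
  define \<phi> where "\<phi> e = (\<Sum>\<alpha>\<in>D. Poly_Mapping.single \<alpha> (c \<alpha> e))" for e
  have "finite D" using fin by (simp add: D_def)
  then have look: "lookup (\<phi> e) \<beta> = (if \<beta> \<in> D then c \<beta> e else 0)" for e \<beta>
    unfolding \<phi>_def lookup_sum lookup_single by (simp add: when_def)
  show ?thesis
  proof
    fix e f assume ef: "e \<in> E" "f \<in> E" "e \<noteq> f"
    then have "d e f \<in> D" by (force simp: D_def)
    then show "lookup (\<phi> e - \<phi> f) (d e f) \<noteq> 0" using c[OF ef] by (simp add: lookup_minus look)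
    \<comment> \<open>At an exponent above \<open>d e f\<close> both points lie in one open ball, so
      their coefficients cancel.\<close>
    show "keys (\<phi> e - \<phi> f) \<subseteq> {..d e f}"
      using c[OF ef] by (auto simp: in_keys_iff lookup_minus look not_less[symmetric] split: if_splits)
  qed
qed

section \<open>Perimeters and greedy orderings\<close>

lemma perimeter_insert:
  assumes "finite A" "x \<notin> A" "\<And>a. a \<in> A \<Longrightarrow> d x a = d a x"
  shows "perimeter w d (insert x A) = perimeter w d A + (w x + (\<Sum>a\<in>A. d x a))"
proof -
  let ?P = "\<lambda>A. {P. P \<subseteq> A \<and> card P = 2}"
  have split: "?P (insert x A) = ?P A \<union> (\<lambda>a. {x, a}) ` A"
  proof (intro equalityI subsetI)
    fix P assume "P \<in> ?P (insert x A)"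
    then show "P \<in> ?P A \<union> (\<lambda>a. {x, a}) ` A" by (auto simp: card_2_iff)
  next
    fix P assume "P \<in> ?P A \<union> (\<lambda>a. {x, a}) ` A"
    then show "P \<in> ?P (insert x A)" using assms(2) by (auto simp: card_2_iff)
  qed
  have "sum (pair_dist d) (?P (insert x A)) =
      sum (pair_dist d) (?P A) + sum (pair_dist d) ((\<lambda>a. {x, a}) ` A)"
    unfolding split using assms(1,2) by (intro sum.union_disjoint) auto
  also have "sum (pair_dist d) ((\<lambda>a. {x, a}) ` A) = (\<Sum>a\<in>A. pair_dist d {x, a})"
    using assms(2) by (subst sum.reindex) (auto simp: inj_on_def doubleton_eq_iff)
  also have "\<dots> = (\<Sum>a\<in>A. d x a)"
    using assms by (intro sum.cong refl pair_dist_eq) auto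
  finally show ?thesis using assms(1,2) by (simp add: perimeter_def algebra_simps)
qed

text \<open>Enumerating the set turns unordered pairs into index pairs i < j, matching the factors
  of the Vandermonde product.\<close>

lemma perimeter_enum:
  fixes k :: nat
  assumes "ultra_triple E w d" "inj_on x {..<k}" "x ` {..<k} \<subseteq> E"
  shows "perimeter w d (x ` {..<k}) = (\<Sum>j<k. w (x j) + (\<Sum>i<j. d (x j) (x i)))"
  using assms(2,3)
proof (induction k)
  case 0
  show ?case by (auto simp: perimeter_def intro!: sum.neutral)
next
  case (Suc k)
  have "x k \<notin> x ` {..<k}" and inj: "inj_on x {..<k}"
    using Suc.prems(1) by (auto simp: lessThan_Suc)
  moreover have "d (x k) a = d a (x k)" if "a \<in> x ` {..<k}" for a
    using Suc.prems(2) that by (intro ultra_sym[OF assms(1)]) auto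
  ultimately have "perimeter w d (insert (x k) (x ` {..<k})) =
      perimeter w d (x ` {..<k}) + (w (x k) + (\<Sum>a\<in>x ` {..<k}. d (x k) a))"
    by (intro perimeter_insert) auto
  then show ?case using Suc.IH Suc.prems inj by (simp add: lessThan_Suc sum.reindex add.commute)
qed

text \<open>By \<open>perimeter_insert\<close>, for symmetric \<open>d\<close> the compared quantity
  is the perimeter gained by adding a point to the prefix. Each step appends a maximiser, which
  leaves the earlier inequalities untouched.\<close>

lemma greedy_ordering:
  fixes w :: "'e \<Rightarrow> 'v::linordered_ab_group_add"
  assumes "finite E"
  obtains a where "inj_on a {..<card E}" "a ` {..<card E} = E"
    "\<And>j e. j < card E \<Longrightarrow> e \<in> E - a ` {..<j} \<Longrightarrow>
      w e + (\<Sum>i<j. d e (a i)) \<le> w (a j) + (\<Sum>i<j. d (a j) (a i))"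
proof -
  have "\<exists>a. inj_on a {..<k} \<and> a ` {..<k} \<subseteq> E \<and> (\<forall>j<k. \<forall>e\<in>E - a ` {..<j}.
      w e + (\<Sum>i<j. d e (a i)) \<le> w (a j) + (\<Sum>i<j. d (a j) (a i)))" if "k \<le> card E" for k
    using that
  proof (induction k)
    case (Suc k)
    then obtain a where a: "inj_on a {..<k}" "a ` {..<k} \<subseteq> E"
      "\<And>j e. j < k \<Longrightarrow> e \<in> E - a ` {..<j} \<Longrightarrow>
        w e + (\<Sum>i<j. d e (a i)) \<le> w (a j) + (\<Sum>i<j. d (a j) (a i))" by auto
    let ?g = "\<lambda>e. w e + (\<Sum>i<k. d e (a i))"
    let ?R = "E - a ` {..<k}"
    have "card (a ` {..<k}) = k" using a(1) by (simp add: card_image)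
    then have "?R \<noteq> {}" using Suc.prems a(2) by auto
    then have "Max (?g ` ?R) \<in> ?g ` ?R" using assms by (intro Max_in) auto
    then obtain m where m: "m \<in> ?R" "?g m = Max (?g ` ?R)" by auto
    have max: "?g e \<le> ?g m" if "e \<in> ?R" for e unfolding m(2) using that assms by (intro Max_ge) auto
    define b where "b = a(k := m)"
    have b: "b i = a i" if "i < k" for i using that by (simp add: b_def)
    have bk: "b k = m" by (simp add: b_def)
    have im: "b ` {..<j} = a ` {..<j}" if "j \<le> k" for j using that b by (intro image_cong) auto
    have sm: "(\<Sum>i<j. d e (b i)) = (\<Sum>i<j. d e (a i))" if "j \<le> k" for j e
      using that b by (intro sum.cong) auto
    have "inj_on b {..<k}" using a(1) b by (simp add: inj_on_def)
    then have "inj_on b {..<Suc k}" using m(1) im[of k] bk by (simp add: lessThan_Suc)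
    moreover have "b ` {..<Suc k} \<subseteq> E" using a(2) m(1) im[of k] bk by (simp add: lessThan_Suc)
    moreover have "w e + (\<Sum>i<j. d e (b i)) \<le> w (b j) + (\<Sum>i<j. d (b j) (b i))"
      if "j < Suc k" "e \<in> E - b ` {..<j}" for j e
    proof (cases "j = k")
      case True
      then show ?thesis using max[of e] that im[of k] sm[of k] bk by simp
    next
      case False
      then show ?thesis using a(3)[of j e] that im[of j] sm[of j] b[of j] by simp
    qed
    ultimately show ?case by blast
  qed simp
  from this[of "card E"] obtain a where a: "inj_on a {..<card E}" "a ` {..<card E} \<subseteq> E"
    "\<forall>j<card E. \<forall>e\<in>E - a ` {..<j}. w e + (\<Sum>i<j. d e (a i)) \<le> w (a j) + (\<Sum>i<j. d (a j) (a i))"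
    by auto
  have "a ` {..<card E} = E" using a(1,2) assms by (simp add: card_image card_subset_eq)
  then show ?thesis using that a by blast
qed

section \<open>Linear independence and determinants\<close>

text \<open>Both sides amount to full rank. Distinctness is a separate condition because the set of
  columns forgets repetitions.\<close>

lemma (in vec_space) det_nonzero_iff_cols_indpt:
  assumes "A \<in> carrier_mat n n"
  shows "det A \<noteq> 0 \<longleftrightarrow> distinct (cols A) \<and> lin_indpt (set (cols A))"
  using assms det_rank_iff[OF assms] non_distinct_low_rank[OF assms] lin_indpt_full_rank[OF assms]
    full_rank_lin_indpt[OF assms] by (metis less_irrefl)

lemma lin_indpt_family_iff_det:
  fixes u :: "'e \<Rightarrow> 'k::field vec"
  assumes "inj_on x {..<k}" "\<And>l. l < k \<Longrightarrow> u (x l) \<in> carrier_vec k"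
  shows "lin_indpt_family k (x ` {..<k}) u \<longleftrightarrow> det (mat k k (\<lambda>(j, l). u (x l) $ j)) \<noteq> 0"
proof -
  interpret vec_space "TYPE('k)" k .
  let ?A = "mat k k (\<lambda>(j, l). u (x l) $ j)"
  have "col ?A l = u (x l)" if "l < k" for l
    using assms(2)[OF that] that by (intro eq_vecI) auto
  then have cols: "cols ?A = map (\<lambda>l. u (x l)) [0..<k]"
    by (intro nth_equalityI) auto
  have "distinct (cols ?A) \<longleftrightarrow> inj_on (u \<circ> x) {..<k}"
    unfolding cols by (simp add: distinct_map lessThan_atLeast0 o_def)
  also have "\<dots> \<longleftrightarrow> inj_on u (x ` {..<k})"
    using assms(1) by (meson comp_inj_on inj_on_imageI)
  finally have "distinct (cols ?A) \<longleftrightarrow> inj_on u (x ` {..<k})" .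
  moreover have "set (cols ?A) = u ` x ` {..<k}"
    unfolding cols by (auto simp: image_image lessThan_atLeast0)
  ultimately show ?thesis
    using det_nonzero_iff_cols_indpt[of ?A] by (simp add: lin_indpt_family_def)
qed

section \<open>The vector family and the comparison of the two greedoids\<close>

theorem theorem4p7:
  fixes E :: "'e set"
    and w :: "'e \<Rightarrow> 'v::linordered_ab_group_add"
    and d :: "'e \<Rightarrow> 'e \<Rightarrow> 'v"
  assumes "finite E"
    and "ultra_triple E w d"
    and "infinite (UNIV :: 'k::field set) \<or> card (UNIV :: 'k set) \<ge> mcs E w d"
  shows "\<exists>m v. m \<ge> card E \<and> (\<forall>e\<in>E. (v e :: 'k vec) \<in> carrier_vec m) \<and>
           bhargava_greedoid E w d = gaussian_elimination_greedoid E v"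
proof -
  obtain \<phi> :: "'e \<Rightarrow> ('v \<Rightarrow>\<^sub>0 'k)" where
    phi: "\<And>e f. e \<in> E \<Longrightarrow> f \<in> E \<Longrightarrow> e \<noteq> f \<Longrightarrow> keys (\<phi> e - \<phi> f) \<subseteq> {..d e f}"
    "\<And>e f. e \<in> E \<Longrightarrow> f \<in> E \<Longrightarrow> e \<noteq> f \<Longrightarrow> lookup (\<phi> e - \<phi> f) (d e f) \<noteq> 0"
    using valadic_embedding[OF assms] by blast
  obtain a where a: "inj_on a {..<card E}" "a ` {..<card E} = E"
    and greedy: "\<And>j e. j < card E \<Longrightarrow> e \<in> E - a ` {..<j} \<Longrightarrow>
      w e + (\<Sum>i<j. d e (a i)) \<le> w (a j) + (\<Sum>i<j. d (a j) (a i))"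
    using greedy_ordering[OF assms(1)] by metis
  have aE: "a j \<in> E" if "j < card E" for j using a(2) that by auto
  \<comment> \<open>The perimeter gain of the \<open>j\<close>-th greedy step; these gains sum to
    the perimeter of a greedy prefix.\<close>
  define c where "c j = w (a j) + (\<Sum>i<j. d (a j) (a i))" for j
  \<comment> \<open>The Newton row \<open>j\<close> at \<open>e\<close>, with row factor t^(- c j)
    and column factor t^(w e), in the shape that \<open>det_scale_rows_cols\<close> expects.\<close>
  define entry where "entry j e = Poly_Mapping.single (- c j) 1 * Poly_Mapping.single (w e) 1 *
    (\<Prod>i<j. \<phi> e - \<phi> (a i))" for j e
  define v where "v e = vec (card E) (\<lambda>j. lookup (entry j e) 0)" for e
  have entry_le: "keys (entry j e) \<subseteq> {..0}" if j: "j < card E" and e: "e \<in> E" for j e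
  proof (cases "e \<in> a ` {..<j}")
    case True
    \<comment> \<open>Greediness says nothing about points already chosen, but there one Newton
      factor vanishes.\<close>
    then have "(\<Prod>i<j. \<phi> e - \<phi> (a i)) = 0" by (auto intro: prod_zero)
    then have "entry j e = 0" unfolding entry_def by (simp only: mult_zero_right)
    then show ?thesis by simp
  next
    case False
    have "keys (\<Prod>i<j. \<phi> e - \<phi> (a i)) \<subseteq> {..\<Sum>i<j. d e (a i)}"
      using False j e aE by (intro prod_top(1) phi) auto
    then have "keys (entry j e) \<subseteq> {..- c j + w e + (\<Sum>i<j. d e (a i))}"
      unfolding entry_def by (intro keys_mult_atMost) auto
    moreover have "- c j + w e + (\<Sum>i<j. d e (a i)) \<le> 0"
      using greedy[of j e] False j e by (simp add: c_def algebra_simps)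
    ultimately show ?thesis by (meson atMost_subset_iff order_trans)
  qed
  have key: "perimeter w d (x ` {..<k}) \<le> (\<Sum>j<k. c j)"
    "det (mat k k (\<lambda>(j, l). lookup (entry j (x l)) 0)) \<noteq> 0 \<longleftrightarrow>
      perimeter w d (x ` {..<k}) = (\<Sum>j<k. c j)"
    if x: "inj_on x {..<k}" "x ` {..<k} \<subseteq> E" and k: "k \<le> card E" for x k
  proof -
    let ?M = "mat k k (\<lambda>(j, l). entry j (x l))"
    let ?p = "perimeter w d (x ` {..<k})"
    \<comment> \<open>This is the degree of \<open>det ?M\<close>: the top exponents of its row,
      column and Vandermonde factors add up to it, and their top coefficients have nonzero product
      in the field.\<close>
    let ?\<delta> = "?p - (\<Sum>j<k. c j)"
    have xE: "x l \<in> E" if "l < k" for l using x(2) that by auto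
    have ne: "x j \<noteq> x i" if "i < j" "j < k" for i j
      using inj_onD[OF x(1), of j i] that by auto
    have sub: "keys (\<phi> (x j) - \<phi> (x i)) \<subseteq> {..d (x j) (x i)}"
      "lookup (\<phi> (x j) - \<phi> (x i)) (d (x j) (x i)) \<noteq> 0" if "i < j" "j < k" for i j
      using phi[of "x j" "x i"] ne[OF that] xE that by auto
    define r s where "r j = Poly_Mapping.single (- c j) (1 :: 'k)"
      and "s j = Poly_Mapping.single (w (x j)) (1 :: 'k)" for j
    define V where "V j = (\<Prod>i<j. \<phi> (x j) - \<phi> (x i))" for j
    have "det ?M = prod r {..<k} * prod s {..<k} * prod V {..<k}"
      unfolding entry_def r_def s_def V_def det_scale_rows_cols det_newton ..
    moreover have "keys (prod r {..<k}) \<subseteq> {..\<Sum>j<k. - c j}"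
      "lookup (prod r {..<k}) (\<Sum>j<k. - c j) \<noteq> 0"
      "keys (prod s {..<k}) \<subseteq> {..\<Sum>j<k. w (x j)}" "lookup (prod s {..<k}) (\<Sum>j<k. w (x j)) \<noteq> 0"
      using prod_top[of "{..<k}" r "\<lambda>j. - c j"] prod_top[of "{..<k}" s "\<lambda>j. w (x j)"]
      by (auto simp: r_def s_def)
    moreover have V: "keys (V j) \<subseteq> {..\<Sum>i<j. d (x j) (x i)}"
      "lookup (V j) (\<Sum>i<j. d (x j) (x i)) \<noteq> 0" if "j < k" for j
      using prod_top[of "{..<j}" "\<lambda>i. \<phi> (x j) - \<phi> (x i)" "\<lambda>i. d (x j) (x i)"] sub that
      unfolding V_def by auto
    have "keys (prod V {..<k}) \<subseteq> {..\<Sum>j<k. \<Sum>i<j. d (x j) (x i)}"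
      "lookup (prod V {..<k}) (\<Sum>j<k. \<Sum>i<j. d (x j) (x i)) \<noteq> 0"
      using prod_top[of "{..<k}" V "\<lambda>j. \<Sum>i<j. d (x j) (x i)"] V by auto
    moreover have "?\<delta> = (\<Sum>j<k. - c j) + (\<Sum>j<k. w (x j)) + (\<Sum>j<k. \<Sum>i<j. d (x j) (x i))"
      unfolding perimeter_enum[OF assms(2) x] by (simp add: sum.distrib sum_negf)
    ultimately have top: "keys (det ?M) \<subseteq> {..?\<delta>}" "lookup (det ?M) ?\<delta> \<noteq> 0"
      by (simp_all add: keys_mult_atMost lookup_mult_top)
    have M: "?M \<in> carrier_mat k k" "\<And>i j. i < k \<Longrightarrow> j < k \<Longrightarrow> keys (?M $$ (i, j)) \<subseteq> {..0}"
      using entry_le xE k by auto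
    \<comment> \<open>The coefficient at \<open>?\<delta>\<close> is nonzero while no exponent
      exceeds 0. The resulting perimeter bound is what later proves greedy prefixes optimal.\<close>
    have le: "?\<delta> \<le> 0" using det_top(1)[OF M] top(2) by (auto simp: in_keys_iff)
    then show "?p \<le> (\<Sum>j<k. c j)" by simp
    have "map_mat (\<lambda>p. lookup p 0) ?M = mat k k (\<lambda>(j, l). lookup (entry j (x l)) 0)"
      by (intro eq_matI) auto
    then have "det (mat k k (\<lambda>(j, l). lookup (entry j (x l)) 0)) = lookup (det ?M) 0"
      using det_top(2)[OF M] by simp
    moreover have "lookup (det ?M) 0 \<noteq> 0 \<longleftrightarrow> ?\<delta> = 0"
    proof
      assume "lookup (det ?M) 0 \<noteq> 0"
      \<comment> \<open>A nonzero constant coefficient forces 0 \<le> \<open>?\<delta>\<close>,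
        which together with \<open>le\<close> gives equality.\<close>
      then have "0 \<in> {..?\<delta>}" using top(1) unfolding in_keys_iff[symmetric] by (rule rev_subsetD)
      then show "?\<delta> = 0" using le by simp
    next
      assume "?\<delta> = 0"
      then show "lookup (det ?M) 0 \<noteq> 0" using top(2) by (rule subst)
    qed
    ultimately show "det (mat k k (\<lambda>(j, l). lookup (entry j (x l)) 0)) \<noteq> 0 \<longleftrightarrow> ?p = (\<Sum>j<k. c j)"
      by simp
  qed
  have enum: "\<exists>x. inj_on x {..<card A} \<and> x ` {..<card A} = A" if "A \<subseteq> E" for A
    using ex_bij_betw_nat_finite[of A] finite_subset[OF that assms(1)]
    by (auto simp: bij_betw_def lessThan_atLeast0)
  have per_le: "perimeter w d A \<le> (\<Sum>j<card A. c j)" if A: "A \<subseteq> E" for A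
    using enum[OF A] key(1) A card_mono[OF assms(1) A] by metis
  have bharg: "A \<in> bhargava_greedoid E w d \<longleftrightarrow> perimeter w d A = (\<Sum>j<card A. c j)"
    if A: "A \<subseteq> E" for A
  proof -
    have k: "card A \<le> card E" by (rule card_mono[OF assms(1) A])
    let ?B = "a ` {..<card A}"
    have inj: "inj_on a {..<card A}" using a(1) k by (auto intro: inj_on_subset)
    have B: "?B \<subseteq> E" "card ?B = card A" using a(2) k inj by (auto simp: card_image)
    \<comment> \<open>The greedy prefix attains the bound \<open>per_le\<close>, so this sum is the
      maximal perimeter for its size.\<close>
    have "perimeter w d ?B = (\<Sum>j<card A. c j)"
      unfolding perimeter_enum[OF assms(2) inj B(1)] c_def ..
    then have "A \<in> bhargava_greedoid E w d \<longleftrightarrow> (\<Sum>j<card A. c j) \<le> perimeter w d A"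
      using A B per_le unfolding bhargava_greedoid_def mem_Collect_eq by (metis order_trans)
    then show ?thesis using per_le[OF A] by auto
  qed
  have gauss: "A \<in> gaussian_elimination_greedoid E v \<longleftrightarrow> perimeter w d A = (\<Sum>j<card A. c j)"
    if A: "A \<subseteq> E" for A
  proof -
    obtain x where x: "inj_on x {..<card A}" "x ` {..<card A} = A" using enum[OF A] by blast
    have k: "card A \<le> card E" by (rule card_mono[OF assms(1) A])
    \<comment> \<open>Projecting to the first \<open>card A\<close> coordinates selects the first
      \<open>card A\<close> Newton rows, so the matrix is the one treated in
      \<open>key\<close>.\<close>
    have "mat (card A) (card A) (\<lambda>(j, l). vec_first (v (x l)) (card A) $ j) =
        mat (card A) (card A) (\<lambda>(j, l). lookup (entry j (x l)) 0)"
      using k by (intro eq_matI) (auto simp: vec_first_def v_def)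
    then show ?thesis
      using lin_indpt_family_iff_det[OF x(1), of "\<lambda>e. vec_first (v e) (card A)"] key(2)[of x "card A"] x k A
      by (simp add: gaussian_elimination_greedoid_def)
  qed
  have "bhargava_greedoid E w d = gaussian_elimination_greedoid E v"
  proof (rule Set.set_eqI)
    fix A
    have "A \<subseteq> E" if "A \<in> bhargava_greedoid E w d \<or> A \<in> gaussian_elimination_greedoid E v"
      using that by (auto simp: bhargava_greedoid_def gaussian_elimination_greedoid_def)
    then show "A \<in> bhargava_greedoid E w d \<longleftrightarrow> A \<in> gaussian_elimination_greedoid E v"
      using bharg gauss by blast
  qed
  moreover have "\<forall>e\<in>E. v e \<in> carrier_vec (card E)" by (simp add: v_def)
  ultimately show ?thesis by blast
qed

end
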